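(* The following dcpos belong to $\mathcal R_2$. (i) Every Scott-sober dcpo, i.e. every dcpo whose Scott space is sober. (ii) Every discrete dcpo. (iii) For every dcpo $D$, the order sobrification $\widehat D=\Omega S(\Sigma D)$. (iv) Every dcpo $D$ such that $\eta_D[D]=\{{\downarrow}x:x\in D\}$ is Skula closed in the standard sobrification $S(\Sigma D)$. (v) Every dcpo $D$ such that $\eta_D[D]$ is Scott closed in $\widehat D$. (vi) Every complete lattice.
   Context: Directed subsets are nonempty; a dcpo is a poset in which every directed subset has a supremum. $\mathbf{DCPO}$ is the category of dcpos and Scott-continuous maps. For dcpos $A,B$, $[A\to B]$ is the dcpo of Scott-continuous maps ordered pointwise. $\Sigma D$ denotes $D$ with its Scott topology; $\Omega X$ denotes a $T_0$ space $X$ with its specialization order. A dcpo is discrete if its order is equality. All full subcategories are closed under isomorphisms. For a $T_0$ space $X$, the standard sobrification $S(X)$ is the set of nonempty irreducible closed subsets of $X$ with the topology whose open sets are $\Diamond U=\{A: A\cap U\ne\varnothing\}$, $U$ open in $X$. For a dcpo $D$, $\widehat D=\Omega S(\Sigma D)$ is thus the set of nonempty irreducible Scott-closed subsets of $D$ ordered by inclusion (a dcpo), and $\eta_D:D\to\widehat D$ is $\eta_D(x)={\downarrow}x$. The Skula topology on a $T_0$ space $X$ with specialization order $\le_X$ is generated by the subbasis consisting of the open subsets of $X$ and the sets ${\downarrow}x=\{y:y\le_Xx\}$, $x\in X$; Skula closed means closed in this topology. Let $2=\{0<1\}$. $E_2$ is the class of all Scott-continuous maps $e:A\to B$ between dcpos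 such that $e^*:[B\to 2]\to[A\to 2]$, $g\mapsto g\circ e$, is an isomorphism of dcpos (equivalently, $e^{-1}$ is an order isomorphism from the lattice of Scott-open sets of $B$ onto that of $A$). $\mathcal R_2=E_2^{\perp}$ is the full subcategory of $\mathbf{DCPO}$ of all dcpos $C$ such that for every $e:A\to B$ in $E_2$ the map $e^*:[B\to C]\to[A\to C]$, $g\mapsto g\circ e$, is an isomorphism of dcpos. (It is the least reflective full subcategory of $\mathbf{DCPO}$ containing $2$.) *)

theory Defs
  imports "HOL-Algebra.Complete_Lattice" "HOL-Analysis.Abstract_Topology"
begin

text \<open>Posets are carrier-based, so that the empty dcpo, function spaces and the order sobrification
  need no separate types. In a \<^locale>\<open>partial_order\<close> the equality field of the record is \<open>(=)\<close>.\<close>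

definition directed :: "'a gorder \<Rightarrow> 'a set \<Rightarrow> bool" where
  "directed D S \<longleftrightarrow> S \<noteq> {} \<and> S \<subseteq> carrier D \<and>
     (\<forall>x\<in>S. \<forall>y\<in>S. \<exists>z\<in>S. x \<sqsubseteq>\<^bsub>D\<^esub> z \<and> y \<sqsubseteq>\<^bsub>D\<^esub> z)"

locale dcpo = partial_order D for D :: "'a gorder" (structure) +
  assumes directed_sup_exists: "directed D S \<Longrightarrow> \<exists>s. is_lub D s S"

definition discrete_order :: "'a gorder \<Rightarrow> bool" where
  "discrete_order D \<longleftrightarrow> (\<forall>x\<in>carrier D. \<forall>y\<in>carrier D. x \<sqsubseteq>\<^bsub>D\<^esub> y \<longleftrightarrow> x = y)"

definition scott_continuous :: "'a gorder \<Rightarrow> 'b gorder \<Rightarrow> ('a \<Rightarrow> 'b) \<Rightarrow> bool" where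
  "scott_continuous A B f \<longleftrightarrow>
     f \<in> carrier A \<rightarrow> carrier B \<and>
     (\<forall>x\<in>carrier A. \<forall>y\<in>carrier A. x \<sqsubseteq>\<^bsub>A\<^esub> y \<longrightarrow> f x \<sqsubseteq>\<^bsub>B\<^esub> f y) \<and>
     (\<forall>S s. directed A S \<and> is_lub A s S \<longrightarrow> is_lub B (f s) (f ` S))"

text \<open>The function space \<open>[A \<rightarrow> B]\<close>. Restricting to extensional functions makes equality of elements
  coincide with equality of maps on the carrier of \<open>A\<close>.\<close>

definition fun_dcpo :: "'a gorder \<Rightarrow> 'b gorder \<Rightarrow> ('a \<Rightarrow> 'b) gorder" where
  "fun_dcpo A B =
     \<lparr> carrier = {f \<in> extensional (carrier A). scott_continuous A B f},
       eq = (=),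
       le = (\<lambda>f g. \<forall>x\<in>carrier A. f x \<sqsubseteq>\<^bsub>B\<^esub> g x) \<rparr>"

definition dcpo_iso :: "'a gorder \<Rightarrow> 'b gorder \<Rightarrow> ('a \<Rightarrow> 'b) \<Rightarrow> bool" where
  "dcpo_iso P Q h \<longleftrightarrow> scott_continuous P Q h \<and>
     (\<exists>k. scott_continuous Q P k \<and>
        (\<forall>x\<in>carrier P. k (h x) = x) \<and> (\<forall>y\<in>carrier Q. h (k y) = y))"

definition two :: "bool gorder" where
  "two = \<lparr> carrier = UNIV, eq = (=), le = (\<le>) \<rparr>"

text \<open>For \<open>e : A \<rightarrow> B\<close>, the map \<open>e\<^sup>* : [B \<rightarrow> C] \<rightarrow> [A \<rightarrow> C]\<close> is \<open>g \<mapsto> compose (carrier A) g e\<close>, the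
  composite \<open>g \<circ> e\<close> as an extensional function on the carrier of \<open>A\<close>.\<close>

definition precomp :: "'a gorder \<Rightarrow> ('a \<Rightarrow> 'b) \<Rightarrow> ('b \<Rightarrow> 'c) \<Rightarrow> ('a \<Rightarrow> 'c)" where
  "precomp A e = (\<lambda>g. compose (carrier A) g e)"

definition E2 :: "'a gorder \<Rightarrow> 'b gorder \<Rightarrow> ('a \<Rightarrow> 'b) set" where
  "E2 A B = {e. dcpo A \<and> dcpo B \<and> scott_continuous A B e \<and>
                dcpo_iso (fun_dcpo B two) (fun_dcpo A two) (precomp A e)}"

text \<open>A definition in HOL cannot quantify over the class of all dcpos, so \<open>R2\<close> takes as parameters
  the types in which the sources and the targets of the maps in \<open>E2\<close> have their elements.
  Membership of \<open>C\<close> in the class \<open>R\<^sub>2\<close> is \<open>C \<in> R2 TYPE('a) TYPE('b)\<close> for all \<open>'a\<close> and \<open>'b\<close>, that is,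
  a theorem in which both type variables are free and occur only in the conclusion.\<close>

definition R2 :: "'a itself \<Rightarrow> 'b itself \<Rightarrow> 'c gorder set" where
  "R2 _ _ = {C. dcpo C \<and>
     (\<forall>(A :: 'a gorder) (B :: 'b gorder). \<forall>e \<in> E2 A B.
        dcpo_iso (fun_dcpo B C) (fun_dcpo A C) (precomp A e))}"

definition scott_open :: "'a gorder \<Rightarrow> 'a set \<Rightarrow> bool" where
  "scott_open D U \<longleftrightarrow> U \<subseteq> carrier D \<and>
     (\<forall>x\<in>U. \<forall>y\<in>carrier D. x \<sqsubseteq>\<^bsub>D\<^esub> y \<longrightarrow> y \<in> U) \<and>
     (\<forall>S s. directed D S \<and> is_lub D s S \<and> s \<in> U \<longrightarrow> S \<inter> U \<noteq> {})"

definition scott_topology :: "'a gorder \<Rightarrow> 'a topology" where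
  "scott_topology D = topology (scott_open D)"

definition spec_order :: "'a topology \<Rightarrow> 'a gorder" where
  "spec_order X =
     \<lparr> carrier = topspace X, eq = (=), le = (\<lambda>x y. x \<in> X closure_of {y}) \<rparr>"

definition irreducible_closed :: "'a topology \<Rightarrow> 'a set \<Rightarrow> bool" where
  "irreducible_closed X A \<longleftrightarrow> closedin X A \<and> A \<noteq> {} \<and>
     (\<forall>B C. closedin X B \<and> closedin X C \<and> A \<subseteq> B \<union> C \<longrightarrow> A \<subseteq> B \<or> A \<subseteq> C)"

definition sober_space :: "'a topology \<Rightarrow> bool" where
  "sober_space X \<longleftrightarrow>
     (\<forall>A. irreducible_closed X A \<longrightarrow> (\<exists>!x. x \<in> topspace X \<and> A = X closure_of {x}))"

definition sobrif_open :: "'a topology \<Rightarrow> 'a set set \<Rightarrow> bool" where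
  "sobrif_open X W \<longleftrightarrow>
     (\<exists>U. openin X U \<and> W = {A. irreducible_closed X A \<and> A \<inter> U \<noteq> {}})"

definition sobrification :: "'a topology \<Rightarrow> 'a set topology" where
  "sobrification X = topology (sobrif_open X)"

definition order_sobrification :: "'a gorder \<Rightarrow> 'a set gorder" where
  "order_sobrification D = spec_order (sobrification (scott_topology D))"

definition eta :: "'a gorder \<Rightarrow> 'a \<Rightarrow> 'a set" where
  "eta D x = {y \<in> carrier D. y \<sqsubseteq>\<^bsub>D\<^esub> x}"

text \<open>In \<open>skula_topology\<close>, \<open>eta (spec_order X) x\<close> is the down-set of \<open>x\<close> in the specialization order.\<close>

definition skula_topology :: "'a topology \<Rightarrow> 'a topology" where
  "skula_topology X = topology_generated_by
     ({U. openin X U} \<union> {eta (spec_order X) x | x. x \<in> topspace X})"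

lemma istopology_scott_open: "istopology (scott_open D)"
  unfolding istopology_def
proof (intro conjI allI impI)
  fix U V assume U: "scott_open D U" and V: "scott_open D V"
  show "scott_open D (U \<inter> V)"
    unfolding scott_open_def
  proof (intro conjI ballI allI impI)
    show "U \<inter> V \<subseteq> carrier D" using U by (auto simp: scott_open_def)
  next
    fix x y assume "x \<in> U \<inter> V" "y \<in> carrier D" "x \<sqsubseteq>\<^bsub>D\<^esub> y"
    then show "y \<in> U \<inter> V" using U V unfolding scott_open_def by blast
  next
    fix S s assume S: "directed D S \<and> is_lub D s S \<and> s \<in> U \<inter> V"
    then obtain a b where a: "a \<in> S" "a \<in> U" and b: "b \<in> S" "b \<in> V"
      using U V unfolding scott_open_def by blast
    then obtain c where c: "c \<in> S" "a \<sqsubseteq>\<^bsub>D\<^esub> c" "b \<sqsubseteq>\<^bsub>D\<^esub> c"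
      using S unfolding directed_def by blast
    moreover have "c \<in> carrier D" using S c unfolding directed_def by blast
    ultimately have "c \<in> U \<inter> V" using a b U V unfolding scott_open_def by blast
    then show "S \<inter> (U \<inter> V) \<noteq> {}" using c by blast
  qed
next
  fix \<K> assume "\<forall>K\<in>\<K>. scott_open D K"
  then have *: "scott_open D K" if "K \<in> \<K>" for K using that by blast
  show "scott_open D (\<Union>\<K>)"
    unfolding scott_open_def
  proof (intro conjI ballI allI impI)
    show "\<Union>\<K> \<subseteq> carrier D" using * unfolding scott_open_def by (meson Union_least)
  next
    fix x y assume "x \<in> \<Union>\<K>" "y \<in> carrier D" "x \<sqsubseteq>\<^bsub>D\<^esub> y"
    then show "y \<in> \<Union>\<K>" using * unfolding scott_open_def by (meson UnionE UnionI)
  next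
    fix S s assume S: "directed D S \<and> is_lub D s S \<and> s \<in> \<Union>\<K>"
    then obtain K where "K \<in> \<K>" "s \<in> K" by blast
    then have "S \<inter> K \<noteq> {}" using *[of K] S unfolding scott_open_def by metis
    then show "S \<inter> \<Union>\<K> \<noteq> {}" using \<open>K \<in> \<K>\<close> by blast
  qed
qed

lemma openin_scott_topology: "openin (scott_topology D) = scott_open D"
  by (simp add: scott_topology_def istopology_scott_open)

lemma topspace_scott_topology: "topspace (scott_topology D) = carrier D"
proof -
  have "scott_open D (carrier D)"
    unfolding scott_open_def directed_def by blast
  then show ?thesis
    unfolding topspace_def openin_scott_topology by (auto simp: scott_open_def)
qed

lemma istopology_sobrif_open: "istopology (sobrif_open X)"
  unfolding istopology_def
proof (intro conjI allI impI)
  fix V W assume "sobrif_open X V" "sobrif_open X W"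
  then obtain S T where S: "openin X S" "V = {A. irreducible_closed X A \<and> A \<inter> S \<noteq> {}}"
    and T: "openin X T" "W = {A. irreducible_closed X A \<and> A \<inter> T \<noteq> {}}"
    unfolding sobrif_open_def by blast
  have "A \<inter> (S \<inter> T) \<noteq> {}"
    if A: "irreducible_closed X A" "A \<inter> S \<noteq> {}" "A \<inter> T \<noteq> {}" for A
  proof
    assume "A \<inter> (S \<inter> T) = {}"
    moreover have "A \<subseteq> topspace X"
      using A by (simp add: irreducible_closed_def closedin_subset)
    ultimately have "A \<subseteq> (topspace X - S) \<union> (topspace X - T)" by blast
    moreover have "closedin X (topspace X - S)" "closedin X (topspace X - T)"
      using S T by auto
    ultimately have "A \<subseteq> topspace X - S \<or> A \<subseteq> topspace X - T"
      using A(1) unfolding irreducible_closed_def by blast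
    then show False using A by blast
  qed
  then have "V \<inter> W = {A. irreducible_closed X A \<and> A \<inter> (S \<inter> T) \<noteq> {}}"
    unfolding S T by blast
  then show "sobrif_open X (V \<inter> W)"
    unfolding sobrif_open_def using S T by blast
next
  fix \<K> assume "\<forall>K\<in>\<K>. sobrif_open X K"
  then have "\<forall>K\<in>\<K>. \<exists>U. openin X U \<and> (\<forall>A. A \<in> K \<longleftrightarrow> irreducible_closed X A \<and> A \<inter> U \<noteq> {})"
    unfolding sobrif_open_def by (simp add: set_eq_iff)
  then obtain f where f: "\<forall>K\<in>\<K>. openin X (f K) \<and>
      (\<forall>A. A \<in> K \<longleftrightarrow> irreducible_closed X A \<and> A \<inter> f K \<noteq> {})"
    by (elim bchoice[THEN exE])
  have "A \<in> \<Union>\<K> \<longleftrightarrow> irreducible_closed X A \<and> A \<inter> \<Union>(f ` \<K>) \<noteq> {}" for A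
  proof -
    have "A \<in> \<Union>\<K> \<longleftrightarrow> (\<exists>K\<in>\<K>. A \<in> K)" by blast
    also have "\<dots> \<longleftrightarrow> (\<exists>K\<in>\<K>. irreducible_closed X A \<and> A \<inter> f K \<noteq> {})"
      using f by (intro bex_cong) simp_all
    finally show ?thesis by blast
  qed
  then have "\<Union>\<K> = {A. irreducible_closed X A \<and> A \<inter> \<Union>(f ` \<K>) \<noteq> {}}"
    by (simp add: set_eq_iff)
  moreover have "openin X (\<Union>(f ` \<K>))" using f by blast
  ultimately show "sobrif_open X (\<Union>\<K>)"
    unfolding sobrif_open_def by blast
qed

lemma openin_sobrification: "openin (sobrification X) = sobrif_open X"
  by (simp add: sobrification_def istopology_sobrif_open)

lemma topspace_sobrification: "topspace (sobrification X) = {A. irreducible_closed X A}"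
proof
  show "topspace (sobrification X) \<subseteq> {A. irreducible_closed X A}"
    unfolding topspace_def openin_sobrification sobrif_open_def by blast
  have "A \<inter> topspace X \<noteq> {}" if "irreducible_closed X A" for A
    using that closedin_subset[of X A] unfolding irreducible_closed_def by blast
  then have "sobrif_open X {A. irreducible_closed X A}"
    unfolding sobrif_open_def by blast
  then show "{A. irreducible_closed X A} \<subseteq> topspace (sobrification X)"
    by (simp add: openin_sobrification[symmetric] openin_subset)
qed

lemma spec_order_scott_topology:
  assumes "partial_order D" and x: "x \<in> carrier D" and y: "y \<in> carrier D"
  shows "x \<sqsubseteq>\<^bsub>spec_order (scott_topology D)\<^esub> y \<longleftrightarrow> x \<sqsubseteq>\<^bsub>D\<^esub> y"
proof -
  interpret partial_order D by fact
  have op: "scott_open D (carrier D - {z. z \<sqsubseteq>\<^bsub>D\<^esub> y})"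
    unfolding scott_open_def
  proof (intro conjI ballI allI impI)
    fix u v assume "u \<in> carrier D - {z. z \<sqsubseteq>\<^bsub>D\<^esub> y}" "v \<in> carrier D" "u \<sqsubseteq>\<^bsub>D\<^esub> v"
    then show "v \<in> carrier D - {z. z \<sqsubseteq>\<^bsub>D\<^esub> y}" using y le_trans[of u v y] by blast
  next
    fix S s assume *: "directed D S \<and> is_lub D s S \<and> s \<in> carrier D - {z. z \<sqsubseteq>\<^bsub>D\<^esub> y}"
    show "S \<inter> (carrier D - {z. z \<sqsubseteq>\<^bsub>D\<^esub> y}) \<noteq> {}"
    proof
      assume "S \<inter> (carrier D - {z. z \<sqsubseteq>\<^bsub>D\<^esub> y}) = {}"
      then have "y \<in> Upper D S" using * y unfolding directed_def Upper_def by blast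
      then show False using * unfolding least_def by blast
    qed
  qed auto
  show ?thesis
  proof
    assume "x \<sqsubseteq>\<^bsub>spec_order (scott_topology D)\<^esub> y"
    then have "\<And>U. x \<in> U \<Longrightarrow> scott_open D U \<Longrightarrow> y \<in> U"
      by (auto simp: spec_order_def in_closure_of openin_scott_topology)
    from this[OF _ op] show "x \<sqsubseteq>\<^bsub>D\<^esub> y" using x y by auto
  next
    assume "x \<sqsubseteq>\<^bsub>D\<^esub> y"
    then show "x \<sqsubseteq>\<^bsub>spec_order (scott_topology D)\<^esub> y"
      using x y
      by (auto simp: spec_order_def in_closure_of openin_scott_topology
          topspace_scott_topology scott_open_def)
  qed
qed

lemma carrier_order_sobrification:
  "carrier (order_sobrification D) = {A. irreducible_closed (scott_topology D) A}"
  by (simp add: order_sobrification_def spec_order_def topspace_sobrification)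

lemma le_order_sobrification:
  assumes "A \<in> carrier (order_sobrification D)" "B \<in> carrier (order_sobrification D)"
  shows "A \<sqsubseteq>\<^bsub>order_sobrification D\<^esub> B \<longleftrightarrow> A \<subseteq> B"
proof -
  let ?X = "scott_topology D"
  have A: "irreducible_closed ?X A" and B: "irreducible_closed ?X B"
    using assms by (auto simp: carrier_order_sobrification)
  have "A \<sqsubseteq>\<^bsub>order_sobrification D\<^esub> B \<longleftrightarrow>
      (\<forall>U. openin ?X U \<and> A \<inter> U \<noteq> {} \<longrightarrow> B \<inter> U \<noteq> {})"
  proof -
    have "A \<sqsubseteq>\<^bsub>order_sobrification D\<^esub> B \<longleftrightarrow> (\<forall>W. A \<in> W \<and> sobrif_open ?X W \<longrightarrow> B \<in> W)"
      using A by (simp add: order_sobrification_def spec_order_def in_closure_of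
          topspace_sobrification openin_sobrification)
    also have "\<dots> \<longleftrightarrow> (\<forall>U. openin ?X U \<longrightarrow>
        A \<in> {C. irreducible_closed ?X C \<and> C \<inter> U \<noteq> {}} \<longrightarrow>
        B \<in> {C. irreducible_closed ?X C \<and> C \<inter> U \<noteq> {}})" (is "?L \<longleftrightarrow> ?R")
    proof
      assume ?R
      show ?L
      proof (intro allI impI, elim conjE)
        fix W assume "A \<in> W" "sobrif_open ?X W"
        then obtain U where "openin ?X U" "W = {C. irreducible_closed ?X C \<and> C \<inter> U \<noteq> {}}"
          unfolding sobrif_open_def by (elim exE conjE)
        with \<open>?R\<close> \<open>A \<in> W\<close> show "B \<in> W" by simp
      qed
    next
      assume L: ?L
      show ?R
      proof (intro allI impI)
        fix U
        let ?W = "{C. irreducible_closed ?X C \<and> C \<inter> U \<noteq> {}}"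
        assume "openin ?X U" "A \<in> ?W"
        moreover from this have "sobrif_open ?X ?W"
          unfolding sobrif_open_def by (intro exI[of _ U] conjI refl)
        ultimately show "B \<in> ?W" using L by (elim allE[of _ ?W]) simp
      qed
    qed
    finally show ?thesis using A B by (simp add: imp_conjL)
  qed
  also have "\<dots> \<longleftrightarrow> A \<subseteq> B"
  proof
    assume *: "\<forall>U. openin ?X U \<and> A \<inter> U \<noteq> {} \<longrightarrow> B \<inter> U \<noteq> {}"
    have "openin ?X (topspace ?X - B)" using B by (auto simp: irreducible_closed_def)
    moreover have "A \<subseteq> topspace ?X" using A by (simp add: irreducible_closed_def closedin_subset)
    ultimately show "A \<subseteq> B" using * by blast
  qed blast
  finally show ?thesis .
qed

end

(*
  A map e in E_2 induces a bijection between the Scott opens of its codomain B and those of its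
  domain A, so maps out of B into any dcpo are determined by, and compared on, the image of e.  Only
  the existence of extensions along e is at stake.  For the order sobrification of D, a map
  f on A extends because, for b in B, the Scott opens U of D for which b lies in the open set of B
  corresponding to {a. f a meets U} form a completely prime filter, that is, an irreducible closed
  set.  For D itself, extend the composite of f with eta to h : B -> order sobrification of D; as
  soon as every h b has a supremum in D, taking suprema gives the extension of f.
*)
theory Submission
  imports Defs
begin

section \<open>Scott-continuous maps and Scott-open sets\<close>

text \<open>Membership in \<open>E2\<close> speaks of Scott opens, not of points of B, so a value at
  b can only be recovered from the opens that ought to contain it. The order sobrification is the
  dcpo whose elements correspond to such families of opens; in D itself a family of this kind need
  not come from a point. The obstacle is real when only \<eta>[D] is Scott closed: Johnstone's
  non-sober dcpo has this property, yet as a whole it is an irreducible closed subset of itself with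
  no upper bound. Hence suprema are demanded only for the sets h b where h takes principal ideals as
  values on the image of e. In the sober, discrete, Skula closed and complete cases all irreducible
  closed sets have suprema: they are principal ideals, or D is complete. Pointwise suprema give a
  continuous map because u bounds h b exactly when h b misses the Scott open complement of \<down>u,
  and continuity of h governs which h b meet a given open.\<close>

lemma scott_openD:
  assumes "scott_open D U"
  shows "U \<subseteq> carrier D"
    and "x \<in> U \<Longrightarrow> y \<in> carrier D \<Longrightarrow> x \<sqsubseteq>\<^bsub>D\<^esub> y \<Longrightarrow> y \<in> U"
    and "directed D S \<Longrightarrow> is_lub D s S \<Longrightarrow> s \<in> U \<Longrightarrow> \<exists>x\<in>S. x \<in> U"
  using assms unfolding scott_open_def by blast+

lemma scott_continuousD:
  assumes "scott_continuous A B f"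
  shows "x \<in> carrier A \<Longrightarrow> f x \<in> carrier B"
    and "x \<in> carrier A \<Longrightarrow> y \<in> carrier A \<Longrightarrow> x \<sqsubseteq>\<^bsub>A\<^esub> y \<Longrightarrow> f x \<sqsubseteq>\<^bsub>B\<^esub> f y"
    and "directed A S \<Longrightarrow> is_lub A s S \<Longrightarrow> is_lub B (f s) (f ` S)"
  using assms unfolding scott_continuous_def by blast+

lemma directed_subset: "directed D S \<Longrightarrow> S \<subseteq> carrier D"
  by (simp add: directed_def)

lemma is_lub_closed: "is_lub D s S \<Longrightarrow> s \<in> carrier D"
  by (simp add: least_def Upper_def)

lemma is_lub_upper: "is_lub D s S \<Longrightarrow> S \<subseteq> carrier D \<Longrightarrow> x \<in> S \<Longrightarrow> x \<sqsubseteq>\<^bsub>D\<^esub> s"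
  by (auto simp: least_def Upper_def)

lemma is_lub_least:
  "is_lub D s S \<Longrightarrow> u \<in> carrier D \<Longrightarrow> (\<And>x. x \<in> S \<Longrightarrow> x \<sqsubseteq>\<^bsub>D\<^esub> u) \<Longrightarrow> s \<sqsubseteq>\<^bsub>D\<^esub> u"
  by (auto simp: least_def Upper_def)

lemma is_lubI:
  assumes "s \<in> carrier D" "\<And>x. x \<in> S \<Longrightarrow> x \<sqsubseteq>\<^bsub>D\<^esub> s"
    "\<And>u. u \<in> carrier D \<Longrightarrow> (\<And>x. x \<in> S \<Longrightarrow> x \<in> carrier D \<Longrightarrow> x \<sqsubseteq>\<^bsub>D\<^esub> u) \<Longrightarrow> s \<sqsubseteq>\<^bsub>D\<^esub> u"
  shows "is_lub D s S"
  using assms by (auto simp: least_def Upper_def)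

lemma directed_image:
  assumes "scott_continuous A B f" "directed A S"
  shows "directed B (f ` S)"
proof -
  have "\<exists>z\<in>S. f x \<sqsubseteq>\<^bsub>B\<^esub> f z \<and> f y \<sqsubseteq>\<^bsub>B\<^esub> f z" if xy: "x \<in> S" "y \<in> S" for x y
  proof -
    obtain z where "z \<in> S" "x \<sqsubseteq>\<^bsub>A\<^esub> z" "y \<sqsubseteq>\<^bsub>A\<^esub> z"
      using xy assms(2) unfolding directed_def by blast
    moreover have "x \<in> carrier A" "y \<in> carrier A" "z \<in> carrier A"
      using xy \<open>z \<in> S\<close> directed_subset[OF assms(2)] by blast+
    ultimately show ?thesis using scott_continuousD(2)[OF assms(1)] by blast
  qed
  moreover have "f ` S \<subseteq> carrier B"
    using scott_continuousD(1)[OF assms(1)] directed_subset[OF assms(2)] by blast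
  moreover have "S \<noteq> {}" using assms(2) by (simp add: directed_def)
  ultimately show ?thesis by (simp add: directed_def)
qed

lemma scott_open_vimage:
  assumes f: "scott_continuous A B f" and U: "scott_open B U"
  shows "scott_open A {x \<in> carrier A. f x \<in> U}"
  unfolding scott_open_def
proof (intro conjI ballI allI impI)
  fix x y assume "x \<in> {x \<in> carrier A. f x \<in> U}" "y \<in> carrier A" "x \<sqsubseteq>\<^bsub>A\<^esub> y"
  then show "y \<in> {x \<in> carrier A. f x \<in> U}"
    using scott_openD(2)[OF U] scott_continuousD[OF f] by blast
next
  fix S s assume *: "directed A S \<and> is_lub A s S \<and> s \<in> {x \<in> carrier A. f x \<in> U}"
  then obtain x where "x \<in> S" "f x \<in> U"
    using scott_openD(3)[OF U directed_image[OF f]] scott_continuousD(3)[OF f] by blast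
  then show "S \<inter> {x \<in> carrier A. f x \<in> U} \<noteq> {}" using * directed_subset[of A S] by blast
qed blast

text \<open>These opens detect the order: if x is not below u, this set contains x but not u. They
  also turn "u is an upper bound of K" into "K misses an open set".\<close>

lemma scott_open_not_below:
  assumes "partial_order D" and u: "u \<in> carrier D"
  shows "scott_open D {x \<in> carrier D. \<not> x \<sqsubseteq>\<^bsub>D\<^esub> u}"
proof -
  interpret partial_order D by fact
  show ?thesis
    unfolding scott_open_def
  proof (intro conjI ballI allI impI)
    fix x y assume "x \<in> {x \<in> carrier D. \<not> x \<sqsubseteq>\<^bsub>D\<^esub> u}" "y \<in> carrier D" "x \<sqsubseteq>\<^bsub>D\<^esub> y"
    then show "y \<in> {x \<in> carrier D. \<not> x \<sqsubseteq>\<^bsub>D\<^esub> u}" using u le_trans[of x y u] by blast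
  next
    fix S s assume *: "directed D S \<and> is_lub D s S \<and> s \<in> {x \<in> carrier D. \<not> x \<sqsubseteq>\<^bsub>D\<^esub> u}"
    then obtain x where "x \<in> S" "\<not> x \<sqsubseteq>\<^bsub>D\<^esub> u" using is_lub_least[of D s S u] u by blast
    then show "S \<inter> {x \<in> carrier D. \<not> x \<sqsubseteq>\<^bsub>D\<^esub> u} \<noteq> {}"
      using * directed_subset[of D S] by blast
  qed blast
qed

text \<open>Elements of \<open>fun_dcpo\<close> are extensional, so maps are constantly replaced by
  their restrictions; continuity depends only on the values on the carrier.\<close>

lemma scott_continuous_cong:
  assumes f: "scott_continuous A B f" and eq: "\<And>x. x \<in> carrier A \<Longrightarrow> f x = g x"
  shows "scott_continuous A B g"
proof -
  have "is_lub B (g s) (g ` S)" if "directed A S" "is_lub A s S" for S s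
  proof -
    have "f ` S = g ` S" using eq directed_subset[OF that(1)] by (intro image_cong) auto
    then show ?thesis
      using scott_continuousD(3)[OF f that] eq[OF is_lub_closed[OF that(2)]] by simp
  qed
  then show ?thesis using f eq unfolding scott_continuous_def by (auto simp: Pi_iff)
qed

section \<open>Scott opens as maps into the two-element chain\<close>

lemma is_lub_two_iff: "is_lub two b S \<longleftrightarrow> (b \<longleftrightarrow> (\<exists>x\<in>S. x))"
proof
  assume "is_lub two b S"
  then have "\<And>x. x \<in> S \<Longrightarrow> x \<le> b" "\<And>u. \<forall>x\<in>S. x \<le> u \<Longrightarrow> b \<le> u"
    by (auto simp: least_def Upper_def two_def)
  from this(1) this(2)[of "\<exists>x\<in>S. x"] show "b \<longleftrightarrow> (\<exists>x\<in>S. x)" by auto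
qed (auto simp: least_def Upper_def two_def)

lemma scott_continuous_two_iff:
  "scott_continuous D two p \<longleftrightarrow> scott_open D {x \<in> carrier D. p x}"
proof
  have "scott_open two {True}"
    unfolding scott_open_def is_lub_two_iff by (auto simp: two_def)
  moreover assume "scott_continuous D two p"
  ultimately show "scott_open D {x \<in> carrier D. p x}"
    using scott_open_vimage by fastforce
next
  assume U: "scott_open D {x \<in> carrier D. p x}"
  show "scott_continuous D two p"
    unfolding scott_continuous_def
  proof (intro conjI ballI allI impI)
    show "p \<in> carrier D \<rightarrow> carrier two" by (simp add: two_def)
  next
    fix x y assume "x \<in> carrier D" "y \<in> carrier D" "x \<sqsubseteq>\<^bsub>D\<^esub> y"
    then show "p x \<sqsubseteq>\<^bsub>two\<^esub> p y" using scott_openD(2)[OF U, of x y] by (auto simp: two_def)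
  next
    fix S s assume *: "directed D S \<and> is_lub D s S"
    then have s: "s \<in> carrier D" and S: "S \<subseteq> carrier D"
      using is_lub_closed directed_subset by blast+
    have "p s" if "x \<in> S" "p x" for x
      using scott_openD(2)[OF U, of x s] that * s S is_lub_upper[of D s S x] by blast
    moreover have "\<exists>x\<in>S. p x" if "p s"
      using scott_openD(3)[OF U, of S s] that * s by blast
    ultimately show "is_lub two (p s) (p ` S)" by (auto simp: is_lub_two_iff)
  qed
qed

section \<open>Extension along maps in \<open>E\<^sub>2\<close>\<close>

text \<open>Surjectivity of \<open>precomp A e\<close> on maps into \<open>two\<close>, read off on
  characteristic functions.\<close>

lemma E2_open_lift:
  assumes e: "e \<in> E2 A B" and U: "scott_open A U"
  shows "\<exists>V. scott_open B V \<and> {a \<in> carrier A. e a \<in> V} = U"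
proof -
  obtain k where k: "scott_continuous (fun_dcpo A two) (fun_dcpo B two) k"
    and inv: "\<And>y. y \<in> carrier (fun_dcpo A two) \<Longrightarrow> precomp A e (k y) = y"
    using e unfolding E2_def dcpo_iso_def by blast
  have ec: "e a \<in> carrier B" if "a \<in> carrier A" for a
    using e that unfolding E2_def by (auto dest: scott_continuousD(1))
  \<comment> \<open>The restriction makes the characteristic function extensional, hence an element
    of \<open>fun_dcpo A two\<close> to which \<open>k\<close> applies.\<close>
  define p where "p = restrict (\<lambda>x. x \<in> U) (carrier A)"
  have "{x \<in> carrier A. p x} = U" using scott_openD(1)[OF U] by (auto simp: p_def)
  then have p: "p \<in> carrier (fun_dcpo A two)"
    using U by (simp add: fun_dcpo_def scott_continuous_two_iff p_def)
  have "k p \<in> carrier (fun_dcpo B two)" by (rule scott_continuousD(1)[OF k p])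
  then have "scott_open B {b \<in> carrier B. k p b}"
    by (simp add: fun_dcpo_def scott_continuous_two_iff)
  moreover have "k p (e a) = (a \<in> U)" if "a \<in> carrier A" for a
    using fun_cong[OF inv[OF p], of a] that by (simp add: precomp_def compose_def p_def)
  ultimately show ?thesis
    using ec scott_openD(1)[OF U] by (intro exI[of _ "{b \<in> carrier B. k p b}"]) auto
qed

text \<open>The inverse \<open>k\<close> is monotone, so the pointwise order on characteristic
  functions is reflected by \<open>precomp A e\<close>. This is the working form of
  \<open>E2\<close>: an inclusion between opens of B need only be tested at the points e a.\<close>

lemma E2_open_reflect:
  assumes e: "e \<in> E2 A B" and V: "scott_open B V" and W: "scott_open B W"
    and sub: "\<And>a. a \<in> carrier A \<Longrightarrow> e a \<in> V \<Longrightarrow> e a \<in> W"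
  shows "V \<subseteq> W"
proof -
  let ?h = "precomp A e"
  obtain k where h: "scott_continuous (fun_dcpo B two) (fun_dcpo A two) ?h"
    and k: "scott_continuous (fun_dcpo A two) (fun_dcpo B two) k"
    and inv: "\<And>x. x \<in> carrier (fun_dcpo B two) \<Longrightarrow> k (?h x) = x"
    using e unfolding E2_def dcpo_iso_def by blast
  let ?p = "\<lambda>U. restrict (\<lambda>b. b \<in> U) (carrier B)"
  have p: "?p U \<in> carrier (fun_dcpo B two)" if "scott_open B U" for U
  proof -
    have "{x \<in> carrier B. ?p U x} = U" using scott_openD(1)[OF that] by auto
    then show ?thesis using that by (simp add: fun_dcpo_def scott_continuous_two_iff)
  qed
  have ec: "e a \<in> carrier B" if "a \<in> carrier A" for a
    using e that unfolding E2_def by (auto dest: scott_continuousD(1))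
  have "?h (?p V) \<sqsubseteq>\<^bsub>fun_dcpo A two\<^esub> ?h (?p W)"
    using sub ec by (auto simp: fun_dcpo_def precomp_def compose_def two_def)
  then have "k (?h (?p V)) \<sqsubseteq>\<^bsub>fun_dcpo B two\<^esub> k (?h (?p W))"
    using scott_continuousD(1)[OF h p[OF V]] scott_continuousD(1)[OF h p[OF W]]
    by (intro scott_continuousD(2)[OF k])
  then have "?p V \<sqsubseteq>\<^bsub>fun_dcpo B two\<^esub> ?p W" by (simp add: inv p V W)
  then show ?thesis using scott_openD(1)[OF V] by (auto simp: fun_dcpo_def two_def)
qed

section \<open>Order isomorphisms and the reduction of \<open>R2\<close> to extensions\<close>

lemma order_iso_scott_continuous:
  assumes h: "\<And>x. x \<in> carrier P \<Longrightarrow> h x \<in> carrier Q" and k: "\<And>y. y \<in> carrier Q \<Longrightarrow> k y \<in> carrier P"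
    and hk: "\<And>y. y \<in> carrier Q \<Longrightarrow> h (k y) = y"
    and le: "\<And>x x'. x \<in> carrier P \<Longrightarrow> x' \<in> carrier P \<Longrightarrow> h x \<sqsubseteq>\<^bsub>Q\<^esub> h x' \<longleftrightarrow> x \<sqsubseteq>\<^bsub>P\<^esub> x'"
  shows "scott_continuous P Q h"
  unfolding scott_continuous_def
proof (intro conjI ballI allI impI)
  fix S s assume *: "directed P S \<and> is_lub P s S"
  then have S: "S \<subseteq> carrier P" and s: "s \<in> carrier P"
    using is_lub_closed directed_subset by blast+
  show "is_lub Q (h s) (h ` S)"
  proof (rule is_lubI)
    fix y assume "y \<in> h ` S"
    then show "y \<sqsubseteq>\<^bsub>Q\<^esub> h s" using * S s le is_lub_upper[of P s S] by blast
  next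
    fix u assume u: "u \<in> carrier Q" and ub: "\<And>y. y \<in> h ` S \<Longrightarrow> y \<in> carrier Q \<Longrightarrow> y \<sqsubseteq>\<^bsub>Q\<^esub> u"
    have "x \<sqsubseteq>\<^bsub>P\<^esub> k u" if "x \<in> S" for x
    proof -
      have "h x \<sqsubseteq>\<^bsub>Q\<^esub> h (k u)" using ub[of "h x"] that S h hk[OF u] by auto
      then show ?thesis using le that S k[OF u] by blast
    qed
    then have "s \<sqsubseteq>\<^bsub>P\<^esub> k u" using * k[OF u] is_lub_least[of P s S "k u"] by blast
    then show "h s \<sqsubseteq>\<^bsub>Q\<^esub> u" using le[OF s k[OF u]] hk[OF u] by simp
  qed (use h s in blast)
qed (use h le in auto)

text \<open>An order isomorphism preserves every supremum that exists, so Scott continuity of both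
  directions is automatic and suprema in the function spaces never have to be computed.\<close>

lemma dcpo_iso_order_iso:
  assumes h: "\<And>x. x \<in> carrier P \<Longrightarrow> h x \<in> carrier Q" and k: "\<And>y. y \<in> carrier Q \<Longrightarrow> k y \<in> carrier P"
    and kh: "\<And>x. x \<in> carrier P \<Longrightarrow> k (h x) = x" and hk: "\<And>y. y \<in> carrier Q \<Longrightarrow> h (k y) = y"
    and le: "\<And>x x'. x \<in> carrier P \<Longrightarrow> x' \<in> carrier P \<Longrightarrow> h x \<sqsubseteq>\<^bsub>Q\<^esub> h x' \<longleftrightarrow> x \<sqsubseteq>\<^bsub>P\<^esub> x'"
  shows "dcpo_iso P Q h"
proof -
  have "scott_continuous P Q h" by (rule order_iso_scott_continuous[of P h Q k]) (use assms in auto)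
  moreover have "k y \<sqsubseteq>\<^bsub>P\<^esub> k y' \<longleftrightarrow> y \<sqsubseteq>\<^bsub>Q\<^esub> y'" if "y \<in> carrier Q" "y' \<in> carrier Q" for y y'
    using le[of "k y" "k y'"] that k hk by simp
  then have "scott_continuous Q P k"
    by (intro order_iso_scott_continuous[of Q k P h]) (use assms in auto)
  ultimately show ?thesis unfolding dcpo_iso_def using kh hk by blast
qed

text \<open>If the inequality failed at b, the complement U of \<down>(g' b) would contain g b. On
  the image of e, preimages of the upper set U under g lie in those under g', hence they do so on
  all of B, which puts g' b into U: absurd.\<close>

lemma E2_map_reflect:
  assumes e: "e \<in> E2 A B" and C: "dcpo C"
    and g: "scott_continuous B C g" and g': "scott_continuous B C g'"
    and le: "\<And>a. a \<in> carrier A \<Longrightarrow> g (e a) \<sqsubseteq>\<^bsub>C\<^esub> g' (e a)" and b: "b \<in> carrier B"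
  shows "g b \<sqsubseteq>\<^bsub>C\<^esub> g' b"
proof (rule ccontr)
  assume neg: "\<not> g b \<sqsubseteq>\<^bsub>C\<^esub> g' b"
  interpret C: dcpo C by fact
  let ?U = "{x \<in> carrier C. \<not> x \<sqsubseteq>\<^bsub>C\<^esub> g' b}"
  have U: "scott_open C ?U"
    by (rule scott_open_not_below[OF C.partial_order_axioms scott_continuousD(1)[OF g' b]])
  have "{x \<in> carrier B. g x \<in> ?U} \<subseteq> {x \<in> carrier B. g' x \<in> ?U}"
  proof (rule E2_open_reflect[OF e scott_open_vimage[OF g U] scott_open_vimage[OF g' U]])
    fix a assume a: "a \<in> carrier A" "e a \<in> {x \<in> carrier B. g x \<in> ?U}"
    then have "g' (e a) \<in> ?U"
      using scott_openD(2)[OF U _ _ le[OF a(1)]] scott_continuousD(1)[OF g', of "e a"] by blast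
    then show "e a \<in> {x \<in> carrier B. g' x \<in> ?U}" using a by blast
  qed
  then have "\<not> g' b \<sqsubseteq>\<^bsub>C\<^esub> g' b" using neg b scott_continuousD(1)[OF g b] by blast
  then show False using scott_continuousD(1)[OF g' b] by simp
qed

lemma R2I:
  fixes C :: "'c gorder"
  assumes C: "dcpo C"
    and ext: "\<And>(A :: 'a gorder) (B :: 'b gorder) e f. e \<in> E2 A B \<Longrightarrow> scott_continuous A C f \<Longrightarrow>
      \<exists>g. scott_continuous B C g \<and> (\<forall>a\<in>carrier A. g (e a) = f a)"
  shows "C \<in> R2 TYPE('a) TYPE('b)"
  unfolding R2_def
proof (intro CollectI conjI allI ballI C)
  fix A :: "'a gorder" and B :: "'b gorder" and e assume e: "e \<in> E2 A B"
  interpret C: dcpo C by fact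
  let ?P = "fun_dcpo B C" and ?Q = "fun_dcpo A C" and ?h = "precomp A e"
  have ec: "scott_continuous A B e" using e by (simp add: E2_def)
  have h: "?h g \<in> carrier ?Q" if "g \<in> carrier ?P" for g
  proof -
    have g: "scott_continuous B C g" using that by (simp add: fun_dcpo_def)
    have "scott_continuous A C (\<lambda>a. g (e a))"
      unfolding scott_continuous_def
    proof (intro conjI ballI allI impI)
      fix S s assume *: "directed A S \<and> is_lub A s S"
      then have "is_lub C (g (e s)) (g ` e ` S)"
        by (intro scott_continuousD(3)[OF g] directed_image[OF ec] scott_continuousD(3)[OF ec]) auto
      then show "is_lub C (g (e s)) ((\<lambda>a. g (e a)) ` S)" by (simp add: image_image)
    qed (auto intro!: scott_continuousD(1,2)[OF g] scott_continuousD(1,2)[OF ec])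
    then have "scott_continuous A C (?h g)"
      by (rule scott_continuous_cong) (simp add: precomp_def compose_def)
    then show ?thesis by (simp add: fun_dcpo_def precomp_def)
  qed
  have le: "?h g \<sqsubseteq>\<^bsub>?Q\<^esub> ?h g' \<longleftrightarrow> g \<sqsubseteq>\<^bsub>?P\<^esub> g'" if "g \<in> carrier ?P" "g' \<in> carrier ?P" for g g'
  proof
    assume "?h g \<sqsubseteq>\<^bsub>?Q\<^esub> ?h g'"
    then have "\<And>a. a \<in> carrier A \<Longrightarrow> g (e a) \<sqsubseteq>\<^bsub>C\<^esub> g' (e a)"
      by (simp add: fun_dcpo_def precomp_def compose_def)
    then show "g \<sqsubseteq>\<^bsub>?P\<^esub> g'"
      using E2_map_reflect[OF e C, of g g'] that by (simp add: fun_dcpo_def)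
  next
    assume "g \<sqsubseteq>\<^bsub>?P\<^esub> g'"
    then show "?h g \<sqsubseteq>\<^bsub>?Q\<^esub> ?h g'"
      using scott_continuousD(1)[OF ec] by (simp add: fun_dcpo_def precomp_def compose_def)
  qed
  have "\<exists>g. g \<in> carrier ?P \<and> ?h g = f" if f: "f \<in> carrier ?Q" for f
  proof -
    obtain g where g: "scott_continuous B C g" "\<And>a. a \<in> carrier A \<Longrightarrow> g (e a) = f a"
      using ext[OF e, of f] f by (auto simp: fun_dcpo_def)
    have "restrict g (carrier B) \<in> carrier ?P"
      using scott_continuous_cong[OF g(1), of "restrict g (carrier B)"] by (simp add: fun_dcpo_def)
    moreover have "?h (restrict g (carrier B)) = f"
    proof (rule extensionalityI[of _ "carrier A"])
      show "f \<in> extensional (carrier A)" using f by (simp add: fun_dcpo_def)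
    qed (use g(2) scott_continuousD(1)[OF ec] in \<open>auto simp: precomp_def compose_def\<close>)
    ultimately show ?thesis by blast
  qed
  \<comment> \<open>\<open>k\<close> is chosen only as a right inverse; the injectivity shown next
    makes it two-sided.\<close>
  then obtain k where k: "\<And>f. f \<in> carrier ?Q \<Longrightarrow> k f \<in> carrier ?P \<and> ?h (k f) = f" by metis
  have inj: "g = g'" if g: "g \<in> carrier ?P" "g' \<in> carrier ?P" "?h g = ?h g'" for g g'
  proof (rule extensionalityI[of _ "carrier B"])
    \<comment> \<open>Reflexivity, rewritten with \<open>?h g = ?h g'\<close>, gives both
      inequalities through \<open>le\<close>.\<close>
    have "?h g \<sqsubseteq>\<^bsub>?Q\<^esub> ?h g" using h[OF g(1)] scott_continuousD(1)[of A C "?h g"]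
      by (simp add: fun_dcpo_def)
    then have "g \<sqsubseteq>\<^bsub>?P\<^esub> g'" "g' \<sqsubseteq>\<^bsub>?P\<^esub> g"
      using le g by metis+
    then show "g b = g' b" if "b \<in> carrier B" for b
      using that g scott_continuousD(1)[of B C] by (intro C.le_antisym) (auto simp: fun_dcpo_def)
  qed (use g in \<open>auto simp: fun_dcpo_def\<close>)
  show "dcpo_iso ?P ?Q ?h"
  proof (rule dcpo_iso_order_iso[where k = k])
    show "k (?h g) = g" if "g \<in> carrier ?P" for g
      using inj[of "k (?h g)" g] k[OF h[OF that]] that by blast
  qed (use h k le in auto)
qed

section \<open>The order sobrification\<close>

text \<open>Passing to complements, irreducibility says that the opens meeting A are closed under
  binary intersection, the form needed to treat A as a filter of opens.\<close>

lemma irreducible_closed_iff: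
  "irreducible_closed X A \<longleftrightarrow> closedin X A \<and> A \<noteq> {} \<and>
    (\<forall>U V. openin X U \<and> openin X V \<and> A \<inter> U \<noteq> {} \<and> A \<inter> V \<noteq> {} \<longrightarrow> A \<inter> (U \<inter> V) \<noteq> {})"
    (is "_ \<longleftrightarrow> closedin X A \<and> _ \<and> ?R")
proof -
  have "(\<forall>B C. closedin X B \<and> closedin X C \<and> A \<subseteq> B \<union> C \<longrightarrow> A \<subseteq> B \<or> A \<subseteq> C) \<longleftrightarrow> ?R"
    (is "?L \<longleftrightarrow> _") if "closedin X A"
  proof
    have A: "A \<subseteq> topspace X" using that by (rule closedin_subset)
    {
      assume L: ?L
      show ?R
      proof (intro allI impI notI, elim conjE)
        fix U V assume *: "openin X U" "openin X V" "A \<inter> U \<noteq> {}" "A \<inter> V \<noteq> {}" "A \<inter> (U \<inter> V) = {}"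
        have "closedin X (topspace X - U)" "closedin X (topspace X - V)" using * by auto
        moreover have "A \<subseteq> (topspace X - U) \<union> (topspace X - V)" using A * by blast
        ultimately have "A \<subseteq> topspace X - U \<or> A \<subseteq> topspace X - V" using L by blast
        then show False using * by blast
      qed
    next
      assume R: ?R
      show ?L
      proof (intro allI impI, elim conjE, rule ccontr)
        fix B C assume *: "closedin X B" "closedin X C" "A \<subseteq> B \<union> C" "\<not> (A \<subseteq> B \<or> A \<subseteq> C)"
        have "openin X (topspace X - B)" "openin X (topspace X - C)" using * by auto
        moreover have "A \<inter> (topspace X - B) \<noteq> {}" "A \<inter> (topspace X - C) \<noteq> {}"
          using A * by blast+
        ultimately have "A \<inter> ((topspace X - B) \<inter> (topspace X - C)) \<noteq> {}" using R by blast
        then show False using * by blast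
      qed
    }
  qed
  then show ?thesis unfolding irreducible_closed_def by blast
qed

text \<open>K is the complement of \<open>?N\<close>, the union of all opens outside the filter P.
  Complete primeness keeps \<open>?N\<close> itself outside P, so an open U satisfies P exactly when
  it is not contained in \<open>?N\<close>, that is, when it meets K.\<close>

lemma completely_prime_filter_point:
  assumes top: "P (topspace X)"
    and int: "\<And>U V. openin X U \<Longrightarrow> openin X V \<Longrightarrow> P U \<Longrightarrow> P V \<Longrightarrow> P (U \<inter> V)"
    and mono: "\<And>U V. openin X U \<Longrightarrow> openin X V \<Longrightarrow> U \<subseteq> V \<Longrightarrow> P U \<Longrightarrow> P V"
    and prime: "\<And>\<U>. (\<And>U. U \<in> \<U> \<Longrightarrow> openin X U) \<Longrightarrow> P (\<Union>\<U>) \<Longrightarrow> \<exists>U\<in>\<U>. P U"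
  shows "\<exists>K. irreducible_closed X K \<and> (\<forall>U. openin X U \<longrightarrow> (K \<inter> U \<noteq> {} \<longleftrightarrow> P U))"
proof -
  let ?N = "\<Union>{U. openin X U \<and> \<not> P U}"
  let ?K = "topspace X - ?N"
  have N: "openin X ?N" by blast
  have hit: "?K \<inter> U \<noteq> {} \<longleftrightarrow> P U" if U: "openin X U" for U
  proof
    assume "?K \<inter> U \<noteq> {}" then show "P U" using U by blast
  next
    assume P: "P U"
    show "?K \<inter> U \<noteq> {}"
    proof
      assume "?K \<inter> U = {}"
      then have "U \<subseteq> ?N" using openin_subset[OF U] by blast
      then have "P ?N" using mono[OF U N] P by blast
      from prime[OF _ this] show False by blast
    qed
  qed
  have "irreducible_closed X ?K"
    unfolding irreducible_closed_iff
  proof (intro conjI allI impI)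
    show "closedin X ?K" using N by blast
    show "?K \<noteq> {}" using hit[of "topspace X"] top by auto
    fix U V assume "openin X U \<and> openin X V \<and> ?K \<inter> U \<noteq> {} \<and> ?K \<inter> V \<noteq> {}"
    then show "?K \<inter> (U \<inter> V) \<noteq> {}" using hit int by (metis openin_Int)
  qed
  then show ?thesis using hit by blast
qed

lemma irreducible_closed_subset_iff:
  assumes "irreducible_closed X K" "irreducible_closed X L"
  shows "K \<subseteq> L \<longleftrightarrow> (\<forall>U. openin X U \<longrightarrow> K \<inter> U \<noteq> {} \<longrightarrow> L \<inter> U \<noteq> {})"
proof
  assume *: "\<forall>U. openin X U \<longrightarrow> K \<inter> U \<noteq> {} \<longrightarrow> L \<inter> U \<noteq> {}"
  have "openin X (topspace X - L)" "K \<subseteq> topspace X"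
    using assms by (auto simp: irreducible_closed_def dest: closedin_subset)
  then show "K \<subseteq> L" using * by blast
qed blast

text \<open>Irreducible closed sets are ordered by inclusion of the families of opens they meet. The
  family of K is the union of those of the members of \<open>\<S>\<close>, hence the least one above
  them.\<close>

lemma is_lub_order_sobrificationI:
  assumes K: "irreducible_closed (scott_topology D) K"
    and S: "\<S> \<subseteq> carrier (order_sobrification D)"
    and hit: "\<And>U. scott_open D U \<Longrightarrow> K \<inter> U \<noteq> {} \<longleftrightarrow> (\<exists>A\<in>\<S>. A \<inter> U \<noteq> {})"
  shows "is_lub (order_sobrification D) K \<S>"
proof (rule is_lubI)
  show Kc: "K \<in> carrier (order_sobrification D)" using K by (simp add: carrier_order_sobrification)
  fix A assume A: "A \<in> \<S>"
  then have "A \<subseteq> K"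
    using S K hit by (subst irreducible_closed_subset_iff[of "scott_topology D"])
      (auto simp: carrier_order_sobrification openin_scott_topology)
  then show "A \<sqsubseteq>\<^bsub>order_sobrification D\<^esub> K" using A S Kc le_order_sobrification by blast
next
  fix L assume L: "L \<in> carrier (order_sobrification D)"
    and ub: "\<And>A. A \<in> \<S> \<Longrightarrow> A \<in> carrier (order_sobrification D) \<Longrightarrow> A \<sqsubseteq>\<^bsub>order_sobrification D\<^esub> L"
  have sub: "A \<subseteq> L" if "A \<in> \<S>" for A
    using ub[OF that] that S L le_order_sobrification by blast
  have "irreducible_closed (scott_topology D) L" using L by (simp add: carrier_order_sobrification)
  from irreducible_closed_subset_iff[OF K this] have "K \<subseteq> L"
    using hit sub unfolding openin_scott_topology by blast
  then show "K \<sqsubseteq>\<^bsub>order_sobrification D\<^esub> L"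
    using K L by (subst le_order_sobrification) (auto simp: carrier_order_sobrification)
qed

lemma partial_order_order_sobrification: "partial_order (order_sobrification D)"
proof -
  have [simp]: "eq (order_sobrification D) = (=)"
    by (simp add: order_sobrification_def spec_order_def)
  show ?thesis
    by unfold_locales (auto simp: le_order_sobrification)
qed

text \<open>A directed union of completely prime filters is again one: nonemptiness gives the whole
  space, upper bounds give intersections. The conclusion names the opens met, not just a supremum,
  since this is what makes the diamond sets Scott open.\<close>

lemma directed_order_sobrification_sup:
  assumes S: "directed (order_sobrification D) \<S>"
  shows "\<exists>K. irreducible_closed (scott_topology D) K \<and>
    (\<forall>U. scott_open D U \<longrightarrow> (K \<inter> U \<noteq> {} \<longleftrightarrow> (\<exists>A\<in>\<S>. A \<inter> U \<noteq> {})))"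
proof -
  let ?X = "scott_topology D"
  have irr: "irreducible_closed ?X A" if "A \<in> \<S>" for A
    using that directed_subset[OF S] by (auto simp: carrier_order_sobrification)
  have "\<exists>K. irreducible_closed ?X K \<and>
      (\<forall>U. openin ?X U \<longrightarrow> (K \<inter> U \<noteq> {} \<longleftrightarrow> (\<exists>A\<in>\<S>. A \<inter> U \<noteq> {})))"
  proof (rule completely_prime_filter_point)
    obtain A where A: "A \<in> \<S>" using S by (auto simp: directed_def)
    then have "A \<noteq> {}" "A \<subseteq> topspace ?X"
      using irr[OF A] by (auto simp: irreducible_closed_def dest: closedin_subset)
    then show "\<exists>A\<in>\<S>. A \<inter> topspace ?X \<noteq> {}" using A by blast
  next
    fix U V assume U: "openin ?X U" and V: "openin ?X V"
      and "\<exists>A\<in>\<S>. A \<inter> U \<noteq> {}" "\<exists>A\<in>\<S>. A \<inter> V \<noteq> {}"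
    then obtain A B where A: "A \<in> \<S>" "A \<inter> U \<noteq> {}" and B: "B \<in> \<S>" "B \<inter> V \<noteq> {}" by blast
    then obtain C where C: "C \<in> \<S>" "A \<sqsubseteq>\<^bsub>order_sobrification D\<^esub> C" "B \<sqsubseteq>\<^bsub>order_sobrification D\<^esub> C"
      using S unfolding directed_def by blast
    then have "A \<subseteq> C" "B \<subseteq> C" using A B directed_subset[OF S] le_order_sobrification by blast+
    then have "C \<inter> U \<noteq> {}" "C \<inter> V \<noteq> {}" using A B by blast+
    then have "C \<inter> (U \<inter> V) \<noteq> {}" using irr[OF C(1)] U V unfolding irreducible_closed_iff by blast
    then show "\<exists>A\<in>\<S>. A \<inter> (U \<inter> V) \<noteq> {}" using C by blast
  qed blast+
  then show ?thesis by (simp add: openin_scott_topology)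
qed

lemma dcpo_order_sobrification: "dcpo (order_sobrification D)"
proof -
  interpret partial_order "order_sobrification D" by (rule partial_order_order_sobrification)
  show ?thesis
  proof
    fix \<S> assume S: "directed (order_sobrification D) \<S>"
    then show "\<exists>K. is_lub (order_sobrification D) K \<S>"
      using directed_order_sobrification_sup[OF S] is_lub_order_sobrificationI directed_subset
      by metis
  qed
qed

lemma scott_open_diamond:
  assumes U: "scott_open D U"
  shows "scott_open (order_sobrification D) {A. irreducible_closed (scott_topology D) A \<and> A \<inter> U \<noteq> {}}"
  unfolding scott_open_def
proof (intro conjI ballI allI impI)
  fix A B assume A: "A \<in> {A. irreducible_closed (scott_topology D) A \<and> A \<inter> U \<noteq> {}}"
    and B: "B \<in> carrier (order_sobrification D)" and le: "A \<sqsubseteq>\<^bsub>order_sobrification D\<^esub> B"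
  have "A \<subseteq> B" using le A B le_order_sobrification carrier_order_sobrification by blast
  then show "B \<in> {A. irreducible_closed (scott_topology D) A \<and> A \<inter> U \<noteq> {}}"
    using A B by (auto simp: carrier_order_sobrification)
next
  fix \<S> L assume *: "directed (order_sobrification D) \<S> \<and> is_lub (order_sobrification D) L \<S> \<and>
    L \<in> {A. irreducible_closed (scott_topology D) A \<and> A \<inter> U \<noteq> {}}"
  then have S: "directed (order_sobrification D) \<S>" and L: "is_lub (order_sobrification D) L \<S>"
    and LU: "L \<inter> U \<noteq> {}" by simp_all
  interpret partial_order "order_sobrification D" by (rule partial_order_order_sobrification)
  obtain K where K: "irreducible_closed (scott_topology D) K"
    and hit: "\<forall>U. scott_open D U \<longrightarrow> (K \<inter> U \<noteq> {} \<longleftrightarrow> (\<exists>A\<in>\<S>. A \<inter> U \<noteq> {}))"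
    using directed_order_sobrification_sup[OF S] by (elim exE conjE)
  \<comment> \<open>\<open>L\<close> is an arbitrary supremum; uniqueness identifies it with
    \<open>K\<close>, whose opens are known.\<close>
  have "is_lub (order_sobrification D) K \<S>"
    by (rule is_lub_order_sobrificationI[OF K directed_subset[OF S] hit[rule_format]])
  then have "K = L" using L by (rule least_unique)
  then have "\<exists>A\<in>\<S>. A \<inter> U \<noteq> {}" using hit[rule_format, OF U] LU by simp
  moreover have "\<S> \<subseteq> {A. irreducible_closed (scott_topology D) A}"
    using directed_subset[OF S] by (simp add: carrier_order_sobrification)
  ultimately show "\<S> \<inter> {A. irreducible_closed (scott_topology D) A \<and> A \<inter> U \<noteq> {}} \<noteq> {}" by blast
qed (auto simp: carrier_order_sobrification)

text \<open>Testing the diamond opens suffices, although the Scott topology of the order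
  sobrification may be strictly finer: diamonds already determine its order and its directed
  suprema.\<close>

lemma scott_continuous_order_sobrification_iff:
  "scott_continuous B (order_sobrification D) h \<longleftrightarrow>
    (\<forall>b\<in>carrier B. irreducible_closed (scott_topology D) (h b)) \<and>
    (\<forall>U. scott_open D U \<longrightarrow> scott_open B {b \<in> carrier B. h b \<inter> U \<noteq> {}})"
proof (intro iffI conjI ballI allI impI)
  assume h: "scott_continuous B (order_sobrification D) h"
  show irr: "irreducible_closed (scott_topology D) (h b)" if "b \<in> carrier B" for b
    using scott_continuousD(1)[OF h that] by (simp add: carrier_order_sobrification)
  fix U assume "scott_open D U"
  from scott_open_vimage[OF h scott_open_diamond[OF this]]
  show "scott_open B {b \<in> carrier B. h b \<inter> U \<noteq> {}}"
    using irr by (simp cong: conj_cong)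
next
  assume *: "(\<forall>b\<in>carrier B. irreducible_closed (scott_topology D) (h b)) \<and>
    (\<forall>U. scott_open D U \<longrightarrow> scott_open B {b \<in> carrier B. h b \<inter> U \<noteq> {}})"
  then have irr: "\<And>b. b \<in> carrier B \<Longrightarrow> irreducible_closed (scott_topology D) (h b)"
    and op: "\<And>U. scott_open D U \<Longrightarrow> scott_open B {b \<in> carrier B. h b \<inter> U \<noteq> {}}" by auto
  show "scott_continuous B (order_sobrification D) h"
    unfolding scott_continuous_def
  proof (intro conjI ballI allI impI)
    show "h \<in> carrier B \<rightarrow> carrier (order_sobrification D)"
      using irr by (simp add: carrier_order_sobrification)
  next
    fix x y assume xy: "x \<in> carrier B" "y \<in> carrier B" "x \<sqsubseteq>\<^bsub>B\<^esub> y"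
    have "h x \<subseteq> h y"
      unfolding irreducible_closed_subset_iff[OF irr[OF xy(1)] irr[OF xy(2)]] openin_scott_topology
    proof (intro allI impI)
      fix U assume "scott_open D U" "h x \<inter> U \<noteq> {}"
      then show "h y \<inter> U \<noteq> {}" using scott_openD(2)[OF op[of U], of x y] xy by blast
    qed
    then show "h x \<sqsubseteq>\<^bsub>order_sobrification D\<^esub> h y"
      using xy irr by (simp add: le_order_sobrification carrier_order_sobrification)
  next
    fix S s assume S: "directed B S \<and> is_lub B s S"
    then have Sc: "S \<subseteq> carrier B" and s: "s \<in> carrier B"
      using is_lub_closed directed_subset by blast+
    show "is_lub (order_sobrification D) (h s) (h ` S)"
    proof (rule is_lub_order_sobrificationI)
      fix U assume U: "scott_open D U"
      have "h s \<inter> U \<noteq> {}" if "b \<in> S" "h b \<inter> U \<noteq> {}" for b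
        using scott_openD(2)[OF op[OF U], of b s] that S Sc s is_lub_upper[of B s S b] by blast
      moreover have "\<exists>b\<in>S. h b \<inter> U \<noteq> {}" if "h s \<inter> U \<noteq> {}"
        using scott_openD(3)[OF op[OF U], of S s] that S s by blast
      ultimately show "h s \<inter> U \<noteq> {} \<longleftrightarrow> (\<exists>A\<in>h ` S. A \<inter> U \<noteq> {})" by blast
    qed (use irr s Sc in \<open>auto simp: carrier_order_sobrification\<close>)
  qed
qed

lemma E2_extend_order_sobrification:
  assumes e: "e \<in> E2 A B" and f: "scott_continuous A (order_sobrification D) f"
  shows "\<exists>g. scott_continuous B (order_sobrification D) g \<and> (\<forall>a\<in>carrier A. g (e a) = f a)"
proof -
  let ?X = "scott_topology D"
  have ec: "e a \<in> carrier B" if "a \<in> carrier A" for a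
    using e that unfolding E2_def by (auto dest: scott_continuousD(1))
  \<comment> \<open>The guard makes the statement hold for every set U, so that choice yields one
    total function F.\<close>
  have "\<exists>V. scott_open D U \<longrightarrow>
      scott_open B V \<and> {a \<in> carrier A. e a \<in> V} = {a \<in> carrier A. f a \<inter> U \<noteq> {}}" for U
    using E2_open_lift[OF e, of "{a \<in> carrier A. f a \<inter> U \<noteq> {}}"] f
    unfolding scott_continuous_order_sobrification_iff by blast
  then obtain F where "\<forall>U. scott_open D U \<longrightarrow>
      scott_open B (F U) \<and> {a \<in> carrier A. e a \<in> F U} = {a \<in> carrier A. f a \<inter> U \<noteq> {}}"
    using choice[of "\<lambda>U V. scott_open D U \<longrightarrow>
      scott_open B V \<and> {a \<in> carrier A. e a \<in> V} = {a \<in> carrier A. f a \<inter> U \<noteq> {}}"] by auto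
  then have F: "\<And>U. scott_open D U \<Longrightarrow> scott_open B (F U)"
    and eF: "\<And>U. scott_open D U \<Longrightarrow> {a \<in> carrier A. e a \<in> F U} = {a \<in> carrier A. f a \<inter> U \<noteq> {}}"
    by simp_all
  have F_iff: "e a \<in> F U \<longleftrightarrow> f a \<inter> U \<noteq> {}" if "a \<in> carrier A" "scott_open D U" for a U
    using eF[OF that(2)] that(1) by blast
  have irr: "irreducible_closed ?X (f a)" if "a \<in> carrier A" for a
    using f that by (simp add: scott_continuous_order_sobrification_iff)
  have "\<exists>K. irreducible_closed ?X K \<and> (\<forall>U. openin ?X U \<longrightarrow> (K \<inter> U \<noteq> {} \<longleftrightarrow> b \<in> F U))"
    if b: "b \<in> carrier B" for b
  \<comment> \<open>Each filter axiom at b follows from an inclusion between opens built from F, and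
    \<open>E2_open_reflect\<close> moves that inclusion to the points e a, where it expresses a
    property of the irreducible closed set f a.\<close>
  proof (rule completely_prime_filter_point)
    have D: "scott_open D (carrier D)" and B: "scott_open B (carrier B)"
      using openin_topspace[of ?X] openin_topspace[of "scott_topology B"]
      by (simp_all add: openin_scott_topology topspace_scott_topology)
    have "carrier B \<subseteq> F (carrier D)"
    proof (rule E2_open_reflect[OF e B F[OF D]])
      fix a assume a: "a \<in> carrier A"
      then have "f a \<noteq> {}" "f a \<subseteq> carrier D"
        using irr[OF a] closedin_subset[of ?X "f a"]
        by (auto simp: irreducible_closed_def topspace_scott_topology)
      then show "e a \<in> F (carrier D)" using F_iff[OF a D] by blast
    qed
    then show "b \<in> F (topspace ?X)" using b by (auto simp: topspace_scott_topology)
  next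
    fix U V assume "openin ?X U" "openin ?X V" and bUV: "b \<in> F U" "b \<in> F V"
    then have UV: "scott_open D U" "scott_open D V" by (simp_all add: openin_scott_topology)
    have op: "scott_open D (U \<inter> V)"
      using UV openin_Int[of ?X U V] by (simp add: openin_scott_topology)
    have "F U \<inter> F V \<subseteq> F (U \<inter> V)"
    proof (rule E2_open_reflect[OF e])
      fix a assume a: "a \<in> carrier A" "e a \<in> F U \<inter> F V"
      then have "f a \<inter> U \<noteq> {}" "f a \<inter> V \<noteq> {}"
        using F_iff[OF a(1) UV(1)] F_iff[OF a(1) UV(2)] by simp_all
      then have "f a \<inter> (U \<inter> V) \<noteq> {}"
        using UV irr[OF a(1)] unfolding irreducible_closed_iff openin_scott_topology by blast
      then show "e a \<in> F (U \<inter> V)" using F_iff[OF a(1) op] by simp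
    next
      show "scott_open B (F U \<inter> F V)"
        using openin_Int[of "scott_topology B" "F U" "F V"] F UV by (simp add: openin_scott_topology)
    qed (rule F[OF op])
    then show "b \<in> F (U \<inter> V)" using bUV by blast
  next
    fix U V assume UV: "openin ?X U" "openin ?X V" "U \<subseteq> V" and "b \<in> F U"
    moreover have "F U \<subseteq> F V"
      by (rule E2_open_reflect[OF e]) (use UV F F_iff in \<open>auto simp: openin_scott_topology\<close>)
    ultimately show "b \<in> F V" by blast
  next
    fix \<U> assume \<U>: "\<And>U. U \<in> \<U> \<Longrightarrow> openin ?X U" and bU: "b \<in> F (\<Union>\<U>)"
    have un: "scott_open D (\<Union>\<U>)" using \<U> openin_Union[of \<U> ?X] by (simp add: openin_scott_topology)
    have op: "scott_open D U" if "U \<in> \<U>" for U using \<U>[OF that] by (simp add: openin_scott_topology)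
    have "F (\<Union>\<U>) \<subseteq> \<Union>(F ` \<U>)"
    proof (rule E2_open_reflect[OF e F[OF un]])
      have "openin (scott_topology B) (\<Union>(F ` \<U>))"
        using F op by (intro openin_Union) (auto simp: openin_scott_topology)
      then show "scott_open B (\<Union>(F ` \<U>))" by (simp add: openin_scott_topology)
      fix a assume a: "a \<in> carrier A" "e a \<in> F (\<Union>\<U>)"
      then obtain U where "U \<in> \<U>" "f a \<inter> U \<noteq> {}" using F_iff[OF a(1) un] by blast
      then show "e a \<in> \<Union>(F ` \<U>)" using F_iff[OF a(1) op] by blast
    qed
    then show "\<exists>U\<in>\<U>. b \<in> F U" using bU by blast
  qed
  then obtain g where g: "\<And>b. b \<in> carrier B \<Longrightarrow> irreducible_closed ?X (g b)"
    and hit: "\<And>b U. b \<in> carrier B \<Longrightarrow> scott_open D U \<Longrightarrow> g b \<inter> U \<noteq> {} \<longleftrightarrow> b \<in> F U"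
    unfolding openin_scott_topology by metis
  have "scott_open B {b \<in> carrier B. g b \<inter> U \<noteq> {}}" if U: "scott_open D U" for U
  proof -
    have "{b \<in> carrier B. g b \<inter> U \<noteq> {}} = F U" using hit U scott_openD(1)[OF F[OF U]] by blast
    then show ?thesis using F[OF U] by simp
  qed
  then have "scott_continuous B (order_sobrification D) g"
    using g by (simp add: scott_continuous_order_sobrification_iff)
  moreover have "g (e a) = f a" if a: "a \<in> carrier A" for a
  proof -
    \<comment> \<open>Two irreducible closed sets that meet the same opens coincide.\<close>
    have "\<And>U. openin ?X U \<Longrightarrow> g (e a) \<inter> U \<noteq> {} \<longleftrightarrow> f a \<inter> U \<noteq> {}"
      using hit ec F_iff a by (simp add: openin_scott_topology)
    then show ?thesis
      using irreducible_closed_subset_iff[of ?X "g (e a)" "f a"]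
        irreducible_closed_subset_iff[of ?X "f a" "g (e a)"] irr g ec a
      by (intro equalityI) auto
  qed
  ultimately show ?thesis by blast
qed

lemma order_sobrification_in_R2: "order_sobrification D \<in> R2 TYPE('a) TYPE('b)"
proof (rule R2I)
  show "dcpo (order_sobrification D)" by (rule dcpo_order_sobrification)
qed (rule E2_extend_order_sobrification)

section \<open>Dcpos in which enough irreducible closed sets have suprema\<close>

lemma scott_closure_of_singleton:
  assumes "partial_order D" "x \<in> carrier D"
  shows "scott_topology D closure_of {x} = eta D x"
proof -
  have "y \<in> scott_topology D closure_of {x} \<longleftrightarrow> y \<sqsubseteq>\<^bsub>D\<^esub> x" if "y \<in> carrier D" for y
    using spec_order_scott_topology[OF assms(1) that assms(2)] by (simp add: spec_order_def)
  then show ?thesis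
    using closure_of_subset_topspace[of "scott_topology D" "{x}"]
    by (auto simp: eta_def topspace_scott_topology)
qed

lemma is_lub_eta: "partial_order D \<Longrightarrow> x \<in> carrier D \<Longrightarrow> is_lub D x (eta D x)"
proof -
  assume "partial_order D" and x: "x \<in> carrier D"
  then interpret partial_order D by simp
  show ?thesis using x by (intro is_lubI) (auto simp: eta_def)
qed

lemma eta_hits_iff:
  assumes "partial_order D" "x \<in> carrier D" "scott_open D U"
  shows "eta D x \<inter> U \<noteq> {} \<longleftrightarrow> x \<in> U"
proof -
  interpret partial_order D by fact
  show ?thesis using assms(2) scott_openD(1,2)[OF assms(3)] by (auto simp: eta_def)
qed

lemma irreducible_closed_eta:
  assumes "partial_order D" "x \<in> carrier D"
  shows "irreducible_closed (scott_topology D) (eta D x)"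
  unfolding irreducible_closed_iff
proof (intro conjI allI impI)
  show "closedin (scott_topology D) (eta D x)"
    using scott_closure_of_singleton[OF assms] closedin_closure_of[of "scott_topology D" "{x}"] by simp
  interpret partial_order D by fact
  show "eta D x \<noteq> {}" using assms(2) by (auto simp: eta_def)
  fix U V
  assume "openin (scott_topology D) U \<and> openin (scott_topology D) V \<and> eta D x \<inter> U \<noteq> {} \<and> eta D x \<inter> V \<noteq> {}"
  then show "eta D x \<inter> (U \<inter> V) \<noteq> {}"
    using eta_hits_iff[OF assms] openin_Int[of "scott_topology D" U V]
    by (metis IntI openin_scott_topology)
qed

lemma scott_continuous_eta_comp:
  assumes D: "partial_order D" and f: "scott_continuous A D f"
  shows "scott_continuous A (order_sobrification D) (\<lambda>a. eta D (f a))"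
  unfolding scott_continuous_order_sobrification_iff
proof (intro conjI ballI allI impI)
  fix U assume U: "scott_open D U"
  have "{a \<in> carrier A. eta D (f a) \<inter> U \<noteq> {}} = {a \<in> carrier A. f a \<in> U}"
    using eta_hits_iff[OF D _ U] scott_continuousD(1)[OF f] by blast
  then show "scott_open A {a \<in> carrier A. eta D (f a) \<inter> U \<noteq> {}}"
    using scott_open_vimage[OF f U] by simp
qed (use irreducible_closed_eta[OF D] scott_continuousD(1)[OF f] in blast)

lemma scott_continuous_lub:
  assumes D: "partial_order D" and h: "scott_continuous B (order_sobrification D) h"
    and r: "\<And>b. b \<in> carrier B \<Longrightarrow> is_lub D (r b) (h b)"
  shows "scott_continuous B D r"
proof -
  have hc: "h b \<subseteq> carrier D" if "b \<in> carrier B" for b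
    using h that closedin_subset[of "scott_topology D" "h b"]
    by (auto simp: scott_continuous_order_sobrification_iff irreducible_closed_def topspace_scott_topology)
  have mono: "r x \<sqsubseteq>\<^bsub>D\<^esub> r y" if "x \<in> carrier B" "y \<in> carrier B" "x \<sqsubseteq>\<^bsub>B\<^esub> y" for x y
  proof (rule is_lub_least[OF r])
    have "h x \<subseteq> h y"
      using scott_continuousD(2)[OF h that] scott_continuousD(1)[OF h] that le_order_sobrification by blast
    then show "z \<sqsubseteq>\<^bsub>D\<^esub> r y" if "z \<in> h x" for z
      using that is_lub_upper[OF r hc] \<open>y \<in> carrier B\<close> by blast
  qed (use that r is_lub_closed in blast)+
  show ?thesis
    unfolding scott_continuous_def
  proof (intro conjI ballI allI impI)
    show "r \<in> carrier B \<rightarrow> carrier D" using r is_lub_closed by blast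
  next
    fix S s assume S: "directed B S \<and> is_lub B s S"
    then have Sc: "S \<subseteq> carrier B" and s: "s \<in> carrier B"
      using is_lub_closed directed_subset by blast+
    show "is_lub D (r s) (r ` S)"
    proof (rule is_lubI)
      show "r s \<in> carrier D" using r[OF s] by (rule is_lub_closed)
      show "y \<sqsubseteq>\<^bsub>D\<^esub> r s" if "y \<in> r ` S" for y
        using that S Sc s mono is_lub_upper[of B s S] by blast
      fix u assume u: "u \<in> carrier D" and ub: "\<And>y. y \<in> r ` S \<Longrightarrow> y \<in> carrier D \<Longrightarrow> y \<sqsubseteq>\<^bsub>D\<^esub> u"
      interpret partial_order D by fact
      let ?U = "{x \<in> carrier D. \<not> x \<sqsubseteq>\<^bsub>D\<^esub> u}"
      have below: "h b \<inter> ?U = {}" if "b \<in> S" for b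
      proof -
        have b: "b \<in> carrier B" using that Sc by blast
        have "r b \<sqsubseteq>\<^bsub>D\<^esub> u" using ub that is_lub_closed[OF r[OF b]] by blast
        then have "z \<sqsubseteq>\<^bsub>D\<^esub> u" if "z \<in> h b" for z
          using le_trans[of z "r b" u] is_lub_upper[OF r[OF b] hc[OF b] that] that hc[OF b] u
            is_lub_closed[OF r[OF b]] by blast
        then show ?thesis by blast
      qed
      have "scott_open B {b \<in> carrier B. h b \<inter> ?U \<noteq> {}}"
        using h scott_open_not_below[OF D u] by (simp add: scott_continuous_order_sobrification_iff)
      from scott_openD(3)[OF this, of S s] have "h s \<inter> ?U = {}" using S s below by blast
      then have "x \<sqsubseteq>\<^bsub>D\<^esub> u" if "x \<in> h s" for x using that subsetD[OF hc[OF s] that] by auto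
      then show "r s \<sqsubseteq>\<^bsub>D\<^esub> u" by (rule is_lub_least[OF r[OF s] u])
    qed
  qed (use mono in blast)
qed

text \<open>Applied to the extension h of \<eta> after f, whose values on the image of e are the
  ideals \<down>(f a). Their suprema are the points f a, so taking suprema does extend f.\<close>

lemma R2I_lub:
  fixes D :: "'c gorder"
  assumes D: "dcpo D"
    and lub: "\<And>(A :: 'a gorder) (B :: 'b gorder) e h b.
      e \<in> E2 A B \<Longrightarrow> scott_continuous B (order_sobrification D) h \<Longrightarrow>
      (\<And>a. a \<in> carrier A \<Longrightarrow> h (e a) \<in> eta D ` carrier D) \<Longrightarrow> b \<in> carrier B \<Longrightarrow> \<exists>x. is_lub D x (h b)"
  shows "D \<in> R2 TYPE('a) TYPE('b)"
proof (rule R2I[OF D])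
  fix A :: "'a gorder" and B :: "'b gorder" and e f
  assume e: "e \<in> E2 A B" and f: "scott_continuous A D f"
  interpret dcpo D by fact
  obtain h where h: "scott_continuous B (order_sobrification D) h"
    and he: "\<And>a. a \<in> carrier A \<Longrightarrow> h (e a) = eta D (f a)"
    using E2_extend_order_sobrification[OF e scott_continuous_eta_comp[OF partial_order_axioms f]] by blast
  have "\<exists>x. is_lub D x (h b)" if "b \<in> carrier B" for b
    using lub[OF e h _ that] he scott_continuousD(1)[OF f] by blast
  then obtain r where r: "\<And>b. b \<in> carrier B \<Longrightarrow> is_lub D (r b) (h b)" by metis
  have "r (e a) = f a" if a: "a \<in> carrier A" for a
  proof -
    have "e a \<in> carrier B" using e a unfolding E2_def by (auto dest: scott_continuousD(1))
    then have "is_lub D (r (e a)) (eta D (f a))" using r he[OF a] by metis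
    then show ?thesis
      using is_lub_eta[OF partial_order_axioms scott_continuousD(1)[OF f a]] least_unique by blast
  qed
  then show "\<exists>g. scott_continuous B D g \<and> (\<forall>a\<in>carrier A. g (e a) = f a)"
    using scott_continuous_lub[OF partial_order_axioms h r] by blast
qed

lemma R2I_irreducible_lub:
  assumes D: "dcpo D"
    and "\<And>K. irreducible_closed (scott_topology D) K \<Longrightarrow> \<exists>x. is_lub D x K"
  shows "D \<in> R2 TYPE('a) TYPE('b)"
proof (rule R2I_lub[OF D])
  fix B :: "'b gorder" and h b
  assume "scott_continuous B (order_sobrification D) h" "b \<in> carrier B"
  then show "\<exists>x. is_lub D x (h b)"
    using assms(2) by (simp add: scott_continuous_order_sobrification_iff)
qed

section \<open>The individual classes of dcpos\<close>

lemma sober_in_R2: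
  assumes "dcpo D" "sober_space (scott_topology D)"
  shows "D \<in> R2 TYPE('a) TYPE('b)"
proof (rule R2I_irreducible_lub[OF assms(1)])
  interpret dcpo D by fact
  fix K assume "irreducible_closed (scott_topology D) K"
  then obtain x where "x \<in> carrier D" "K = scott_topology D closure_of {x}"
    using assms(2) unfolding sober_space_def topspace_scott_topology by blast
  then show "\<exists>x. is_lub D x K"
    using scott_closure_of_singleton is_lub_eta partial_order_axioms by metis
qed

text \<open>Every member of a directed set lies below the supremum and therefore equals it, so the
  supremum is itself a member.\<close>

lemma scott_open_discrete:
  assumes "discrete_order D" "U \<subseteq> carrier D"
  shows "scott_open D U"
  unfolding scott_open_def
proof (intro conjI ballI allI impI)
  fix S s assume *: "directed D S \<and> is_lub D s S \<and> s \<in> U"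
  then obtain x where x: "x \<in> S" "x \<in> carrier D" unfolding directed_def by blast
  then have "x \<sqsubseteq>\<^bsub>D\<^esub> s" using * is_lub_upper[of D s S x] directed_subset[of D S] by simp
  then have "x = s" using assms x * by (auto simp: discrete_order_def)
  then show "S \<inter> U \<noteq> {}" using x * by blast
qed (use assms in \<open>auto simp: discrete_order_def\<close>)

lemma discrete_in_R2:
  assumes "dcpo D" "discrete_order D"
  shows "D \<in> R2 TYPE('a) TYPE('b)"
proof (rule R2I_irreducible_lub[OF assms(1)])
  interpret dcpo D by fact
  fix K assume K: "irreducible_closed (scott_topology D) K"
  then have Kc: "K \<subseteq> carrier D"
    using closedin_subset[of "scott_topology D" K]
    by (auto simp: irreducible_closed_def topspace_scott_topology)
  obtain x where x: "x \<in> K" using K by (auto simp: irreducible_closed_def)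
  \<comment> \<open>Otherwise K would meet two disjoint opens, {x} and its complement, against
    irreducibility.\<close>
  have "K \<inter> (carrier D - {x}) = {}"
  proof (rule ccontr)
    assume "K \<inter> (carrier D - {x}) \<noteq> {}"
    moreover have "scott_open D {x}" "scott_open D (carrier D - {x})"
      using x Kc by (auto intro!: scott_open_discrete[OF assms(2)])
    ultimately have "K \<inter> ({x} \<inter> (carrier D - {x})) \<noteq> {}"
      using K x unfolding irreducible_closed_iff openin_scott_topology by blast
    then show False by blast
  qed
  then have "K = {x}" using x Kc by blast
  moreover have xc: "x \<in> carrier D" using x Kc by blast
  then have "eta D x = {x}" using assms(2) by (auto simp: eta_def discrete_order_def)
  ultimately show "\<exists>x. is_lub D x K" using is_lub_eta[OF partial_order_axioms xc] by auto
qed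

text \<open>Every Skula neighbourhood of \<open>K\<close> contains \<open>\<down>x\<close> for some \<open>x \<in> K\<close>, so \<open>\<eta>\<^sub>D[D]\<close> is Skula dense,
  and it is Skula closed only if it is everything, i.e. only if \<open>D\<close> is Scott-sober.\<close>

lemma skula_neighbourhood:
  assumes "openin (skula_topology (sobrification (scott_topology D))) W" "K \<in> W"
    and K: "irreducible_closed (scott_topology D) K"
  shows "\<exists>U. scott_open D U \<and> K \<inter> U \<noteq> {} \<and>
    (\<forall>L. irreducible_closed (scott_topology D) L \<and> L \<subseteq> K \<and> L \<inter> U \<noteq> {} \<longrightarrow> L \<in> W)"
proof -
  let ?X = "scott_topology D"
  have "generate_topology_on
      ({U. openin (sobrification ?X) U} \<union>
       {eta (spec_order (sobrification ?X)) x | x. x \<in> topspace (sobrification ?X)}) W"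
    using assms(1) by (simp add: skula_topology_def openin_topology_generated_by_iff)
  then show ?thesis using assms(2)
  proof induction
    case (Int V W)
    obtain U where U: "scott_open D U" "K \<inter> U \<noteq> {}"
      "\<And>L. irreducible_closed ?X L \<Longrightarrow> L \<subseteq> K \<Longrightarrow> L \<inter> U \<noteq> {} \<Longrightarrow> L \<in> V"
      using Int.IH(1) Int.prems by blast
    obtain U' where U': "scott_open D U'" "K \<inter> U' \<noteq> {}"
      "\<And>L. irreducible_closed ?X L \<Longrightarrow> L \<subseteq> K \<Longrightarrow> L \<inter> U' \<noteq> {} \<Longrightarrow> L \<in> W"
      using Int.IH(2) Int.prems by blast
    have "scott_open D (U \<inter> U')"
      using U(1) U'(1) openin_Int[of ?X U U'] by (simp add: openin_scott_topology)
    \<comment> \<open>Irreducibility of K is what lets the two witnesses be intersected.\<close>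
    moreover have "K \<inter> (U \<inter> U') \<noteq> {}"
      using K U(1,2) U'(1,2) unfolding irreducible_closed_iff openin_scott_topology by blast
    moreover have "L \<in> V \<inter> W" if "irreducible_closed ?X L" "L \<subseteq> K" "L \<inter> (U \<inter> U') \<noteq> {}" for L
      using U(3)[of L] U'(3)[of L] that by blast
    ultimately show ?case by blast
  next
    case (UN \<K>)
    then obtain V where V: "V \<in> \<K>" "K \<in> V" by blast
    then show ?case using UN.IH[OF V] by blast
  next
    case (Basis V)
    then consider "sobrif_open ?X V"
      | M where "irreducible_closed ?X M" "V = eta (order_sobrification D) M"
      by (auto simp: openin_sobrification topspace_sobrification order_sobrification_def)
    then show ?case
    proof cases
      case 1
      then obtain U where "scott_open D U" "V = {A. irreducible_closed ?X A \<and> A \<inter> U \<noteq> {}}"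
        unfolding sobrif_open_def openin_scott_topology by blast
      then show ?thesis using Basis.prems by blast
    next
      case 2
      have V: "L \<in> V \<longleftrightarrow> L \<subseteq> M" if "irreducible_closed ?X L" for L
        using that 2 by (simp add: eta_def le_order_sobrification carrier_order_sobrification)
      \<comment> \<open>A subbasic ideal \<down>M containing K contains everything below K, so the
        whole carrier serves as U.\<close>
      have "scott_open D (carrier D)"
        using openin_topspace[of ?X] by (simp add: openin_scott_topology topspace_scott_topology)
      moreover have "K \<inter> carrier D \<noteq> {}"
        using K closedin_subset[of ?X K] by (auto simp: irreducible_closed_def topspace_scott_topology)
      moreover have "L \<in> V" if "irreducible_closed ?X L" "L \<subseteq> K" for L
        using V[OF that(1)] V[OF K] that(2) Basis.prems by simp
      ultimately show ?thesis by blast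
    qed
  qed simp
qed

lemma skula_closed_in_R2:
  assumes D: "dcpo D"
    and cl: "closedin (skula_topology (sobrification (scott_topology D))) (eta D ` carrier D)"
  shows "D \<in> R2 TYPE('a) TYPE('b)"
proof (rule R2I_irreducible_lub[OF D])
  interpret dcpo D by fact
  let ?S = "skula_topology (sobrification (scott_topology D))"
  fix K assume K: "irreducible_closed (scott_topology D) K"
  \<comment> \<open>The points of a generated topology are those covered by its subbasis; the whole
    sobrification is one of the subbasic sets.\<close>
  have "openin (sobrification (scott_topology D)) (topspace (sobrification (scott_topology D)))" by simp
  then have "topspace (sobrification (scott_topology D)) \<subseteq> topspace ?S"
    unfolding skula_topology_def topology_generated_by_topspace by blast
  then have KS: "K \<in> topspace ?S" using K by (auto simp: topspace_sobrification)
  have "K \<in> eta D ` carrier D"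
  proof (rule ccontr)
    assume "K \<notin> eta D ` carrier D"
    moreover have "openin ?S (topspace ?S - eta D ` carrier D)" using cl by (simp add: closedin_def)
    ultimately have "\<exists>U. scott_open D U \<and> K \<inter> U \<noteq> {} \<and>
      (\<forall>L. irreducible_closed (scott_topology D) L \<and> L \<subseteq> K \<and> L \<inter> U \<noteq> {} \<longrightarrow>
        L \<in> topspace ?S - eta D ` carrier D)"
      using KS by (intro skula_neighbourhood[OF _ _ K]) simp_all
    then obtain U where U: "scott_open D U" "K \<inter> U \<noteq> {}"
      and avoid: "\<forall>L. irreducible_closed (scott_topology D) L \<and> L \<subseteq> K \<and> L \<inter> U \<noteq> {} \<longrightarrow>
        L \<in> topspace ?S - eta D ` carrier D" by (elim exE conjE)
    from U(2) obtain x where x: "x \<in> K" "x \<in> U" by blast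
    have xc: "x \<in> carrier D" using scott_openD(1)[OF U(1)] x by blast
    have "eta D x \<subseteq> K"
    proof -
      have "closedin (scott_topology D) K" using K by (simp add: irreducible_closed_def)
      then have "scott_topology D closure_of {x} \<subseteq> K" using x by (simp add: closure_of_minimal)
      then show ?thesis using scott_closure_of_singleton[OF partial_order_axioms xc] by simp
    qed
    moreover have "eta D x \<inter> U \<noteq> {}" using eta_hits_iff[OF partial_order_axioms xc U(1)] x by simp
    ultimately show False
      using avoid[rule_format, of "eta D x"] irreducible_closed_eta[OF partial_order_axioms xc] xc by simp
  qed
  then obtain x where "x \<in> carrier D" "K = eta D x" by blast
  then show "\<exists>x. is_lub D x K" using is_lub_eta[OF partial_order_axioms, of x] by auto
qed

text \<open>The complement of \<eta>[D] is Scott open, and its preimage under h contains no point e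
  a. Compared with the empty open it must be empty, so every h b is a principal ideal.\<close>

lemma eta_scott_closed_in_R2:
  assumes D: "dcpo D"
    and cl: "closedin (scott_topology (order_sobrification D)) (eta D ` carrier D)"
  shows "D \<in> R2 TYPE('a) TYPE('b)"
proof (rule R2I_lub[OF D])
  fix A :: "'a gorder" and B :: "'b gorder" and e h b
  assume e: "e \<in> E2 A B" and h: "scott_continuous B (order_sobrification D) h"
    and he: "\<And>a. a \<in> carrier A \<Longrightarrow> h (e a) \<in> eta D ` carrier D" and b: "b \<in> carrier B"
  interpret dcpo D by fact
  let ?U = "carrier (order_sobrification D) - eta D ` carrier D"
  have "scott_open (order_sobrification D) ?U"
    using cl by (simp add: closedin_def openin_scott_topology topspace_scott_topology)
  from scott_open_vimage[OF h this] have V: "scott_open B {b \<in> carrier B. h b \<in> ?U}" .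
  have "scott_open B {}" using openin_empty[of "scott_topology B"] by (simp add: openin_scott_topology)
  then have "{b \<in> carrier B. h b \<in> ?U} \<subseteq> {}" using E2_open_reflect[OF e V] he by blast
  then have "h b \<in> eta D ` carrier D" using b scott_continuousD(1)[OF h b] by blast
  then obtain x where "x \<in> carrier D" "h b = eta D x" by blast
  then show "\<exists>x. is_lub D x (h b)" using is_lub_eta[OF partial_order_axioms, of x] by auto
qed

lemma complete_lattice_in_R2:
  assumes "complete_lattice D"
  shows "D \<in> R2 TYPE('a) TYPE('b)"
proof -
  interpret complete_lattice D by fact
  have "dcpo D" by unfold_locales (use sup_exists directed_subset in blast)
  then show ?thesis
  proof (rule R2I_irreducible_lub)
    fix K assume "irreducible_closed (scott_topology D) K"
    then have "K \<subseteq> carrier D"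
      using closedin_subset[of "scott_topology D" K]
      by (auto simp: irreducible_closed_def topspace_scott_topology)
    then show "\<exists>x. is_lub D x K" by (rule sup_exists)
  qed
qed

theorem corollary4p9:
  fixes D :: "'c gorder"
  shows "(dcpo D \<and> sober_space (scott_topology D) \<longrightarrow> D \<in> R2 TYPE('a) TYPE('b)) \<and>
    (dcpo D \<and> discrete_order D \<longrightarrow> D \<in> R2 TYPE('a) TYPE('b)) \<and>
    (dcpo D \<longrightarrow> order_sobrification D \<in> R2 TYPE('a) TYPE('b)) \<and>
    (dcpo D \<and> closedin (skula_topology (sobrification (scott_topology D))) (eta D ` carrier D)
       \<longrightarrow> D \<in> R2 TYPE('a) TYPE('b)) \<and>
    (dcpo D \<and> closedin (scott_topology (order_sobrification D)) (eta D ` carrier D)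
       \<longrightarrow> D \<in> R2 TYPE('a) TYPE('b)) \<and>
    (complete_lattice D \<longrightarrow> D \<in> R2 TYPE('a) TYPE('b))"
  by (intro conjI impI; (elim conjE)?)
    (rule sober_in_R2 discrete_in_R2 order_sobrification_in_R2 skula_closed_in_R2
      eta_scott_closed_in_R2 complete_lattice_in_R2; assumption)+

end
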